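(* Let $f:\mathbb{Z}^{+}\to\mathbb{R}^{+}$ and let $n$ be a positive integer with $f(n)\le \frac{n}{1000}$. If $G$ is a graph with $n$ vertices and exactly $\frac{n^2}{4}-nf(n)$ edges in which every edge is contained in at least one triangle, then either $bk(G)>\frac{n}{1000}$ or $f(n)\,(f(n)+bk(G))\,bk(G)\ge \frac{n^2}{1250}$.
   Context: Graphs are finite and simple. A book of size $q$ in a graph is a set of $q$ triangles sharing a common edge. $bk(G)$ denotes the size of the largest book in $G$, i.e. the maximum over edges $e$ of $G$ of the number of triangles of $G$ containing $e$. *)

theory Defs
  imports Complex_Main "HOL-Library.Ramsey"
begin

text \<open>Edges are two-element sets of vertices, so loops and multiple edges are excluded.\<close>

definition simple_graph :: "'a set \<Rightarrow> 'a set set \<Rightarrow> bool" where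
  "simple_graph V E \<longleftrightarrow> finite V \<and> E \<subseteq> nsets V 2"

definition triangles :: "'a set \<Rightarrow> 'a set set \<Rightarrow> 'a set set" where
  "triangles V E = {T \<in> nsets V 3. clique T E}"

definition book :: "'a set \<Rightarrow> 'a set set \<Rightarrow> 'a set set \<Rightarrow> bool" where
  "book V E B \<longleftrightarrow> B \<subseteq> triangles V E \<and> (\<exists>e\<in>E. \<forall>T\<in>B. e \<subseteq> T)"

text \<open>Meaningful only for a finite graph with at least one edge: without edges there are no
  books and the maximum is unspecified.\<close>

definition bk :: "'a set \<Rightarrow> 'a set set \<Rightarrow> nat" where
  "bk V E = Max {card B | B. book V E B}"

lemma bk_eq_Max_edges:
  assumes "simple_graph V E" and "E \<noteq> {}"
  shows "bk V E = Max ((\<lambda>e. card {T \<in> triangles V E. e \<subseteq> T}) ` E)"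
proof -
  have finV: "finite V" and EV: "E \<subseteq> nsets V 2"
    using assms(1) by (auto simp: simple_graph_def)
  have "triangles V E \<subseteq> Pow V" by (auto simp: triangles_def nsets_def)
  then have finT: "finite (triangles V E)" using finV by (meson finite_Pow_iff finite_subset)
  have "E \<subseteq> Pow V" using EV by (auto simp: nsets_def)
  then have finE: "finite E" using finV by (meson finite_Pow_iff finite_subset)
  let ?A = "{card B | B. book V E B}"
  let ?c = "\<lambda>e. card {T \<in> triangles V E. e \<subseteq> T}"
  have sub: "?A \<subseteq> card ` Pow (triangles V E)" by (auto simp: book_def)
  have finA: "finite ?A" by (rule finite_subset[OF sub]) (simp add: finT)
  have mem: "?c ` E \<subseteq> ?A"
  proof
    fix x assume "x \<in> ?c ` E"
    then obtain e where e: "e \<in> E" "x = ?c e" by blast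
    have "book V E {T \<in> triangles V E. e \<subseteq> T}" using e(1) by (auto simp: book_def)
    then show "x \<in> ?A" using e(2) by blast
  qed
  have ub: "a \<le> Max (?c ` E)" if a: "a \<in> ?A" for a
  proof -
    obtain B where B: "a = card B" "book V E B" using a by blast
    obtain e where e: "e \<in> E" "\<forall>T\<in>B. e \<subseteq> T" using B(2) by (auto simp: book_def)
    have "B \<subseteq> {T \<in> triangles V E. e \<subseteq> T}" using B(2) e(2) by (auto simp: book_def)
    then have "a \<le> ?c e" unfolding B(1) by (intro card_mono) (simp_all add: finT)
    also have "\<dots> \<le> Max (?c ` E)" using finE e(1) by (intro Max_ge) auto
    finally show ?thesis .
  qed
  have "Max (?c ` E) \<in> ?c ` E" using finE assms(2) by (intro Max_in) auto
  then have "Max (?c ` E) \<in> ?A" using mem by blast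
  then show ?thesis unfolding bk_def by (intro Max_eqI finA ub) auto
qed

end

theory Submission
  imports Defs "HOL-Analysis.Convex"
begin

text \<open>
  Write \<open>b\<close> for the book number, \<open>d\<close> for degrees and \<open>t\<close> for codegrees, so \<open>t \<le> b\<close> on edges.
  Since \<open>d x + d y - n \<le> t x y\<close>, every edge satisfies \<open>(b - t) (d x + d y - n - t) \<le> 0\<close>; summing
  this and bounding \<open>d x + d y + d z \<le> n + t x y + t y z + t x z\<close> over all triangles gives
  \<open>\<Sum>d\<^sup>2 \<le> n |E|\<close> as soon as \<open>6 b \<le> n\<close>. With \<open>|E| = n\<^sup>2/4 - n f\<close>, Cauchy-Schwarz on the complement
  shows that only \<open>O(f)\<close> vertices have small degree. On the other hand \<open>\<Sum>d\<^sup>2 \<ge> 4 |E|\<^sup>2 / n\<close>, so for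
  at least half of the edges \<open>d x + d y \<ge> n - b - 8 f\<close>, and any triangle on such an edge has an apex
  of degree at most \<open>4 b + 8 f\<close>. A vertex of that degree is in \<open>O(b (b + f))\<close> triangles, so the
  \<open>O(f)\<close> small vertices can serve \<open>\<Omega>(n\<^sup>2)\<close> edges only if \<open>f b (b + f)\<close> is of order \<open>n\<^sup>2\<close>.
\<close>

section \<open>Degrees and codegrees of a symmetric 0/1 matrix\<close>

locale adjacency =
  fixes V :: "'a set" and a :: "'a \<Rightarrow> 'a \<Rightarrow> real"
  assumes finite_V: "finite V"
    and sym: "a x y = a y x"
    and zero_one: "a x y = 0 \<or> a x y = 1"
begin

definition deg :: "'a \<Rightarrow> real" where
  "deg x = (\<Sum>y\<in>V. a x y)"

definition codeg :: "'a \<Rightarrow> 'a \<Rightarrow> real" where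
  "codeg x y = (\<Sum>z\<in>V. a x z * a y z)"

lemma a_nonneg [simp]: "0 \<le> a x y"
  using zero_one[of x y] by auto

lemma codeg_nonneg: "0 \<le> codeg x y"
  unfolding codeg_def by (simp add: sum_nonneg)

lemma codeg_sym: "codeg x y = codeg y x"
  unfolding codeg_def by (simp add: mult.commute)

lemma deg_add_le: "deg x + deg y \<le> card V + codeg x y"
proof -
  have "deg x + deg y = (\<Sum>z\<in>V. a x z + a y z)"
    by (simp add: deg_def sum.distrib)
  also have "\<dots> \<le> (\<Sum>z\<in>V. 1 + a x z * a y z)"
  proof (rule sum_mono)
    fix z show "a x z + a y z \<le> 1 + a x z * a y z"
      using zero_one[of x z] zero_one[of y z] by auto
  qed
  finally show ?thesis by (simp add: codeg_def sum.distrib)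
qed

text \<open>Bonferroni's inequality for three neighbourhoods: a vertex lying in j of them adds j on
  the left and 1 + j(j-1)/2 on the right.\<close>

lemma deg_add_add_le: "deg x + deg y + deg z \<le> card V + codeg x y + codeg y z + codeg x z"
proof -
  have "deg x + deg y + deg z = (\<Sum>w\<in>V. a x w + a y w + a z w)"
    by (simp add: deg_def sum.distrib)
  also have "\<dots> \<le> (\<Sum>w\<in>V. 1 + a x w * a y w + a y w * a z w + a x w * a z w)"
  proof (rule sum_mono)
    fix w show "a x w + a y w + a z w \<le> 1 + a x w * a y w + a y w * a z w + a x w * a z w"
      using zero_one[of x w] zero_one[of y w] zero_one[of z w] by auto
  qed
  finally show ?thesis by (simp add: codeg_def sum.distrib)
qed

lemma sum_a_deg: "(\<Sum>x\<in>V. \<Sum>y\<in>V. a x y * deg x) = (\<Sum>x\<in>V. (deg x)\<^sup>2)"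
  by (simp add: deg_def power2_eq_square sum_distrib_right)

lemma sum_a_deg': "(\<Sum>x\<in>V. \<Sum>y\<in>V. a x y * deg y) = (\<Sum>x\<in>V. (deg x)\<^sup>2)"
  by (subst sum.swap) (simp add: sum_a_deg[symmetric] sym)

section \<open>Triangle counts and the sum of squared degrees\<close>

definition tri :: "'a \<Rightarrow> 'a \<Rightarrow> 'a \<Rightarrow> real" where
  "tri x y z = a x y * a y z * a x z"

lemma tri_nonneg: "0 \<le> tri x y z"
  by (simp add: tri_def)

lemma tri_rotate: "tri x y z = tri y z x"
  by (simp add: tri_def sym[of z x] sym[of y x] mult_ac)

lemma sum_tri: "(\<Sum>z\<in>V. tri x y z) = a x y * codeg x y"
  by (simp add: tri_def codeg_def sum_distrib_left mult_ac)

lemma sum_rotate: "(\<Sum>x\<in>V. \<Sum>y\<in>V. \<Sum>z\<in>V. g x y z) = (\<Sum>x\<in>V. \<Sum>y\<in>V. \<Sum>z\<in>V. g y z x)"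
  for g :: "'a \<Rightarrow> 'a \<Rightarrow> 'a \<Rightarrow> real"
proof -
  have "(\<Sum>x\<in>V. \<Sum>y\<in>V. \<Sum>z\<in>V. g y z x) = (\<Sum>y\<in>V. \<Sum>x\<in>V. \<Sum>z\<in>V. g y z x)"
    by (rule sum.swap)
  also have "\<dots> = (\<Sum>y\<in>V. \<Sum>z\<in>V. \<Sum>x\<in>V. g y z x)"
    by (intro sum.cong refl sum.swap)
  finally show ?thesis by simp
qed

text \<open>\<open>deg_add_add_le\<close> is summed over ordered triangles. By cyclic symmetry the
  three degrees contribute equally, and so do the three codegrees; summing out the third vertex
  turns \<open>tri x y z\<close> into \<open>a x y * codeg x y\<close>.\<close>

lemma sum_tri_deg:
  "3 * (\<Sum>x\<in>V. \<Sum>y\<in>V. a x y * codeg x y * deg x) \<le>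
     card V * (\<Sum>x\<in>V. \<Sum>y\<in>V. a x y * codeg x y) + 3 * (\<Sum>x\<in>V. \<Sum>y\<in>V. a x y * (codeg x y)\<^sup>2)"
proof -
  let ?S = "\<lambda>g. \<Sum>x\<in>V. \<Sum>y\<in>V. \<Sum>z\<in>V. tri x y z * g x y z"
  have rot: "?S g = ?S (\<lambda>x y z. g y z x)" for g
    by (subst sum_rotate) (simp add: tri_rotate[symmetric])
  have d1: "?S (\<lambda>x y z. deg y) = ?S (\<lambda>x y z. deg x)"
    by (rule rot[symmetric, of "\<lambda>x y z. deg x"])
  have d2: "?S (\<lambda>x y z. deg z) = ?S (\<lambda>x y z. deg x)"
    using rot[of "\<lambda>x y z. deg y"] d1 by simp
  have t1: "?S (\<lambda>x y z. codeg y z) = ?S (\<lambda>x y z. codeg x y)"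
    by (rule rot[symmetric, of "\<lambda>x y z. codeg x y"])
  have t2: "?S (\<lambda>x y z. codeg x z) = ?S (\<lambda>x y z. codeg x y)"
    using rot[of "\<lambda>x y z. codeg y z"] t1 by (simp add: codeg_sym)
  have "?S (\<lambda>x y z. deg x + deg y + deg z) \<le> ?S (\<lambda>x y z. card V + codeg x y + codeg y z + codeg x z)"
    by (intro sum_mono mult_left_mono deg_add_add_le tri_nonneg)
  then have "3 * ?S (\<lambda>x y z. deg x) \<le> ?S (\<lambda>x y z. card V) + 3 * ?S (\<lambda>x y z. codeg x y)"
    by (simp only: distrib_left sum.distrib d1 d2 t1 t2)
  moreover have "?S (\<lambda>x y z. g x y) = (\<Sum>x\<in>V. \<Sum>y\<in>V. a x y * codeg x y * g x y)" for g
    by (simp only: sum_distrib_right[symmetric] sum_tri)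
  ultimately have "3 * (\<Sum>x\<in>V. \<Sum>y\<in>V. a x y * codeg x y * deg x) \<le>
      (\<Sum>x\<in>V. \<Sum>y\<in>V. a x y * codeg x y * card V) + 3 * (\<Sum>x\<in>V. \<Sum>y\<in>V. a x y * codeg x y * codeg x y)"
    by simp
  then show ?thesis
    by (simp add: sum_distrib_left power2_eq_square mult_ac)
qed

lemma sum_deg_squared_le:
  fixes b :: real
  assumes b: "b > 0" "6 * b \<le> card V"
    and codeg_le: "\<And>x y. x \<in> V \<Longrightarrow> y \<in> V \<Longrightarrow> a x y = 1 \<Longrightarrow> codeg x y \<le> b"
  shows "2 * (\<Sum>x\<in>V. (deg x)\<^sup>2) \<le> card V * (\<Sum>x\<in>V. deg x)"
proof -
  define \<tau> where "\<tau> = (\<Sum>x\<in>V. \<Sum>y\<in>V. a x y * codeg x y)"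
  define Q where "Q = (\<Sum>x\<in>V. \<Sum>y\<in>V. a x y * (codeg x y)\<^sup>2)"
  define D where "D = (\<Sum>x\<in>V. \<Sum>y\<in>V. a x y * codeg x y * deg x)"
  define S where "S = (\<Sum>x\<in>V. (deg x)\<^sup>2)"
  define N where "N = real (card V)"
  \<comment> \<open>With weight \<open>b\<close> alone the sum would leave an error
    \<open>b * \<tau>\<close>. The part weighted by \<open>codeg x y\<close> sets
    \<open>2 * D - N * \<tau> - Q\<close> against it, and the triangle bound on \<open>D\<close>
    makes this at most \<open>Q - N * \<tau> / 3\<close>.\<close>
  have "a x y * ((b - codeg x y) * (deg x + deg y - N - codeg x y)) \<le> 0" if "x \<in> V" "y \<in> V" for x y
    using zero_one[of x y] codeg_le[OF that] deg_add_le[of x y]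
    by (cases "a x y = 0") (auto simp: N_def intro!: mult_nonneg_nonpos)
  then have "(\<Sum>x\<in>V. \<Sum>y\<in>V. a x y * ((b - codeg x y) * (deg x + deg y - N - codeg x y))) \<le> 0"
    by (intro sum_nonpos) auto
  also have "(\<Sum>x\<in>V. \<Sum>y\<in>V. a x y * ((b - codeg x y) * (deg x + deg y - N - codeg x y))) =
      (\<Sum>x\<in>V. \<Sum>y\<in>V. b * (a x y * deg x) + b * (a x y * deg y) - b * N * a x y
         - b * (a x y * codeg x y) - a x y * codeg x y * deg x - a x y * codeg x y * deg y
         + N * (a x y * codeg x y) + a x y * (codeg x y)\<^sup>2)"
    by (intro sum.cong refl) (simp add: algebra_simps power2_eq_square)
  also have "\<dots> = b * S + b * S - b * N * (\<Sum>x\<in>V. deg x) - b * \<tau> - D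
      - (\<Sum>x\<in>V. \<Sum>y\<in>V. a x y * codeg x y * deg y) + N * \<tau> + Q"
    by (simp add: sum.distrib sum_subtractf sum_distrib_left[symmetric] sum_a_deg sum_a_deg'
        S_def[symmetric] \<tau>_def[symmetric] D_def[symmetric] Q_def[symmetric] deg_def[symmetric])
  also have "(\<Sum>x\<in>V. \<Sum>y\<in>V. a x y * codeg x y * deg y) = D"
    unfolding D_def by (subst sum.swap) (simp add: sym codeg_sym)
  finally have main: "2 * b * S - b * N * (\<Sum>x\<in>V. deg x) - b * \<tau> - 2 * D + N * \<tau> + Q \<le> 0"
    by (simp add: algebra_simps)
  have D: "3 * D \<le> N * \<tau> + 3 * Q"
    using sum_tri_deg by (simp add: D_def \<tau>_def Q_def N_def)
  have "a x y * (codeg x y)\<^sup>2 \<le> b * (a x y * codeg x y)" if "x \<in> V" "y \<in> V" for x y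
    using zero_one[of x y] codeg_le[OF that] codeg_nonneg[of x y]
    by (auto simp: power2_eq_square intro: mult_right_mono)
  then have Q: "Q \<le> b * \<tau>"
    unfolding Q_def \<tau>_def sum_distrib_left by (intro sum_mono) auto
  have "0 \<le> \<tau>"
    unfolding \<tau>_def by (intro sum_nonneg mult_nonneg_nonneg codeg_nonneg) auto
  then have "6 * b * \<tau> \<le> N * \<tau>"
    using b unfolding N_def by (intro mult_right_mono) auto
  \<comment> \<open>Eliminating \<open>D\<close> and then \<open>Q\<close> bounds the left side by
    \<open>(2 * b - N / 3) * \<tau>\<close>, which is where the condition
    \<open>6 * b \<le> N\<close> comes from.\<close>
  then have "b * (2 * S - N * (\<Sum>x\<in>V. deg x)) \<le> 0"
    using main D Q by (simp add: algebra_simps)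
  then show ?thesis
    using b by (simp add: mult_le_0_iff S_def N_def)
qed

section \<open>Vertices of small degree\<close>

lemma card_low_degree:
  fixes \<delta> :: real
  defines "L \<equiv> {x \<in> V. deg x \<le> \<delta>}"
  assumes S: "2 * (\<Sum>x\<in>V. (deg x)\<^sup>2) \<le> card V * (\<Sum>x\<in>V. deg x)"
    and \<delta>: "0 \<le> \<delta>" "\<delta> * card V \<le> (\<Sum>x\<in>V. deg x)"
  shows "2 * ((\<Sum>x\<in>V. deg x) - \<delta> * card L)\<^sup>2 \<le>
    (real (card V) - real (card L)) * (card V * (\<Sum>x\<in>V. deg x))"
proof -
  have L: "L \<subseteq> V" "finite L" and le: "card L \<le> card V"
    using finite_V by (auto simp: L_def card_mono)
  \<comment> \<open>Vertices of \<open>L\<close> carry little of the degree sum, so the other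
    vertices must carry the rest, and Cauchy-Schwarz over these fewer vertices forces a large sum of
    squares.\<close>
  have "(\<Sum>x\<in>L. deg x) \<le> card L * \<delta>"
    by (rule sum_bounded_above) (simp add: L_def)
  then have "(\<Sum>x\<in>V. deg x) - \<delta> * card L \<le> (\<Sum>x\<in>V - L. deg x)"
    using sum.subset_diff[OF L(1) finite_V, of deg] by (simp add: mult.commute)
  \<comment> \<open>With the second part of the hypothesis on \<open>\<delta>\<close>, this makes
    the smaller side nonnegative before both sides are squared.\<close>
  moreover have "\<delta> * card L \<le> \<delta> * card V"
    using \<delta>(1) le by (intro mult_left_mono) auto
  ultimately have "((\<Sum>x\<in>V. deg x) - \<delta> * card L)\<^sup>2 \<le> (\<Sum>x\<in>V - L. deg x)\<^sup>2"
    using \<delta>(2) by (intro power_mono) auto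
  also have "\<dots> \<le> (\<Sum>x\<in>V - L. (deg x)\<^sup>2) * card (V - L)"
    by (rule sum_squared_le_sum_of_squares)
  also have "\<dots> \<le> (\<Sum>x\<in>V. (deg x)\<^sup>2) * card (V - L)"
    by (intro mult_right_mono sum_mono2 finite_V) auto
  also have "real (card (V - L)) = real (card V) - real (card L)"
    using L le by (simp add: card_Diff_subset)
  finally have "2 * ((\<Sum>x\<in>V. deg x) - \<delta> * card L)\<^sup>2 \<le>
      (real (card V) - real (card L)) * (2 * (\<Sum>x\<in>V. (deg x)\<^sup>2))"
    by (simp add: mult_ac)
  also have "\<dots> \<le> (real (card V) - real (card L)) * (card V * (\<Sum>x\<in>V. deg x))"
    using le by (intro mult_left_mono S) auto
  finally show ?thesis .
qed

text \<open>Double counting of triangles with apex in \<open>L\<close>: at least half of the ordered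
  edges have such an apex, while a vertex of \<open>L\<close> has at most
  \<open>4 * b + 8 * f\<close> neighbours and at most \<open>b\<close> common neighbours with
  each.\<close>

lemma sum_deg_le_low_degree:
  fixes b f :: real
  defines "L \<equiv> {x \<in> V. deg x \<le> 4 * b + 8 * f}"
  assumes codeg_le: "\<And>x y. x \<in> V \<Longrightarrow> y \<in> V \<Longrightarrow> a x y = 1 \<Longrightarrow> codeg x y \<le> b"
    and apex: "\<And>x y. x \<in> V \<Longrightarrow> y \<in> V \<Longrightarrow> a x y = 1 \<Longrightarrow> \<exists>z\<in>V. a x z = 1 \<and> a y z = 1"
    and bf: "0 \<le> b" "0 < f"
    and M: "(\<Sum>x\<in>V. deg x) = (real (card V))\<^sup>2 / 2 - 2 * real (card V) * f"
  shows "(\<Sum>x\<in>V. deg x) \<le> 2 * real (card L) * b * (4 * b + 8 * f)"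
proof (cases "V = {}")
  case False
  define N where "N = real (card V)"
  define m where "m = (\<Sum>x\<in>V. deg x)"
  define \<theta> where "\<theta> = 2 * b + 8 * f"
  define good where "good = (\<lambda>x y. a x y * of_bool (deg x + deg y \<ge> N + b - \<theta>))"
  have N: "N > 0"
    using False finite_V by (simp add: N_def card_gt_0_iff)
  have \<theta>: "\<theta> > 0"
    using bf by (simp add: \<theta>_def)
  have L: "L \<subseteq> V" "finite L"
    using finite_V by (auto simp: L_def)
  have sum_a: "(\<Sum>x\<in>V. \<Sum>y\<in>V. a x y) = m"
    by (simp add: m_def deg_def)
  have m: "m = N\<^sup>2 / 2 - 2 * N * f"
    using M by (simp add: m_def N_def)

  \<comment> \<open>Cauchy-Schwarz, with one factor \<open>m\<close> written as
    \<open>N * (N / 2 - 2 * f)\<close>. It says that \<open>deg x + deg y\<close> has mean at least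
    \<open>N - 4 * f\<close> over the edges, so \<open>N + b - deg x - deg y\<close> has mean at
    most \<open>b + 4 * f\<close>, half of \<open>\<theta>\<close>.\<close>
  have "m\<^sup>2 \<le> (\<Sum>x\<in>V. (deg x)\<^sup>2) * N"
    unfolding m_def N_def by (rule sum_squared_le_sum_of_squares)
  then have "m * (N / 2 - 2 * f) * N \<le> (\<Sum>x\<in>V. (deg x)\<^sup>2) * N"
    by (simp add: m power2_eq_square algebra_simps)
  then have "m * (N - 4 * f) * N \<le> 2 * (\<Sum>x\<in>V. (deg x)\<^sup>2) * N"
    by (simp add: algebra_simps)
  then have S: "m * (N - 4 * f) \<le> 2 * (\<Sum>x\<in>V. (deg x)\<^sup>2)"
    using N by (rule mult_right_le_imp_le)

  \<comment> \<open>Markov's inequality for \<open>n + b - d x - d y \<ge> 0\<close>, whose mean over the edges is at most \<open>\<theta> / 2\<close>\<close>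
  have "\<theta> * a x y - \<theta> * good x y \<le> (N + b) * a x y - a x y * deg x - a x y * deg y"
    if "x \<in> V" "y \<in> V" for x y
    using zero_one[of x y] codeg_le[OF that] deg_add_le[of x y]
    by (auto simp: good_def N_def of_bool_def)
  then have "(\<Sum>x\<in>V. \<Sum>y\<in>V. \<theta> * a x y - \<theta> * good x y) \<le>
      (\<Sum>x\<in>V. \<Sum>y\<in>V. (N + b) * a x y - a x y * deg x - a x y * deg y)"
    by (intro sum_mono) auto
  then have "\<theta> * m - \<theta> * (\<Sum>x\<in>V. \<Sum>y\<in>V. good x y) \<le> (N + b) * m - 2 * (\<Sum>x\<in>V. (deg x)\<^sup>2)"
    by (simp add: sum_subtractf sum_distrib_left[symmetric]
        sum_a_deg sum_a_deg' sum_a)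
  also have "\<dots> \<le> \<theta> * (m / 2)"
    using S by (simp add: \<theta>_def algebra_simps)
  finally have "\<theta> * (m / 2) \<le> \<theta> * (\<Sum>x\<in>V. \<Sum>y\<in>V. good x y)"
    by simp
  then have half: "m \<le> 2 * (\<Sum>x\<in>V. \<Sum>y\<in>V. good x y)"
    using \<theta> by simp

  have "good x y \<le> (\<Sum>z\<in>L. tri x y z)" if xy: "x \<in> V" "y \<in> V" for x y
  proof (cases "good x y = 0")
    case True
    then show ?thesis by (simp add: sum_nonneg tri_nonneg)
  next
    case False
    then have axy: "a x y = 1" and large: "deg x + deg y \<ge> N + b - \<theta>"
      using zero_one[of x y] by (auto simp: good_def)
    obtain z where z: "z \<in> V" "a x z = 1" "a y z = 1"
      using apex[OF xy axy] by blast
    \<comment> \<open>The three degrees add up to at most \<open>N + 3 * b\<close>, and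
      \<open>x\<close>, \<open>y\<close> already account for \<open>N + b - \<theta>\<close>. The
      remainder \<open>2 * b + \<theta>\<close> is the threshold defining \<open>L\<close>.\<close>
    have "deg z \<le> 4 * b + 8 * f"
      using deg_add_add_le[of x y z] large codeg_le[OF xy axy] codeg_le[OF xy(1) z(1,2)] codeg_le[OF xy(2) z(1,3)]
      by (simp add: \<theta>_def N_def)
    then have "z \<in> L"
      using z by (simp add: L_def)
    then have "tri x y z \<le> (\<Sum>z\<in>L. tri x y z)"
      using L by (intro member_le_sum tri_nonneg) auto
    then show ?thesis
      using z axy by (simp add: tri_def good_def of_bool_def)
  qed
  then have "(\<Sum>x\<in>V. \<Sum>y\<in>V. good x y) \<le> (\<Sum>x\<in>V. \<Sum>y\<in>V. \<Sum>z\<in>L. tri x y z)"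
    by (intro sum_mono) auto
  also have "\<dots> = (\<Sum>x\<in>V. \<Sum>z\<in>L. \<Sum>y\<in>V. tri x y z)"
    by (intro sum.cong refl sum.swap)
  \<comment> \<open>The same triangles are now counted from the apex: its neighbours
    \<open>x\<close> first, then the common neighbours of \<open>z\<close> and
    \<open>x\<close>.\<close>
  also have "\<dots> = (\<Sum>z\<in>L. \<Sum>x\<in>V. \<Sum>y\<in>V. tri z x y)"
    by (subst sum.swap) (simp add: tri_rotate[symmetric])
  also have "\<dots> = (\<Sum>z\<in>L. \<Sum>x\<in>V. a z x * codeg z x)"
    by (simp add: sum_tri)
  also have "\<dots> \<le> (\<Sum>z\<in>L. \<Sum>x\<in>V. a z x * b)"
  proof (intro sum_mono)
    fix z x assume "z \<in> L" "x \<in> V"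
    then show "a z x * codeg z x \<le> a z x * b"
      using zero_one[of z x] codeg_le[of z x] L by auto
  qed
  also have "\<dots> = (\<Sum>z\<in>L. deg z * b)"
    by (simp add: deg_def sum_distrib_right)
  also have "\<dots> \<le> (\<Sum>z\<in>L. (4 * b + 8 * f) * b)"
    using bf by (intro sum_mono mult_right_mono) (auto simp: L_def)
  finally show ?thesis
    using half by (simp add: m_def algebra_simps)
qed (use bf in simp)

section \<open>Combining the estimates numerically\<close>

lemma book_bound:
  fixes b f :: real
  defines "n \<equiv> real (card V)"
  assumes codeg_le: "\<And>x y. x \<in> V \<Longrightarrow> y \<in> V \<Longrightarrow> a x y = 1 \<Longrightarrow> codeg x y \<le> b"
    and apex: "\<And>x y. x \<in> V \<Longrightarrow> y \<in> V \<Longrightarrow> a x y = 1 \<Longrightarrow> \<exists>z\<in>V. a x z = 1 \<and> a y z = 1"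
    and b: "0 < b" "b \<le> n / 1000"
    and f: "0 < f" "f \<le> n / 1000"
    and M: "(\<Sum>x\<in>V. deg x) = n\<^sup>2 / 2 - 2 * n * f"
  shows "n\<^sup>2 / 1250 \<le> f * (f + b) * b"
proof -
  define \<delta> where "\<delta> = 4 * b + 8 * f"
  define k where "k = real (card {x \<in> V. deg x \<le> \<delta>})"
  have n: "n > 0"
    using b by simp
  have k: "0 \<le> k" "k \<le> n"
    using finite_V by (auto simp: k_def n_def intro!: card_mono)
  have \<delta>: "0 \<le> \<delta>" "\<delta> \<le> 12 / 1000 * n"
    using b f by (auto simp: \<delta>_def)
  have nf: "n * f \<le> n * (n / 1000)"
    using n f by (intro mult_left_mono) auto
  have n\<delta>: "\<delta> * n \<le> 12 / 1000 * n * n"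
    using n \<delta> by (intro mult_right_mono) auto
  have S: "2 * (\<Sum>x\<in>V. (deg x)\<^sup>2) \<le> card V * (\<Sum>x\<in>V. deg x)"
    by (rule sum_deg_squared_le[OF b(1) _ codeg_le]) (use b in \<open>simp_all add: n_def\<close>)
  have "0 \<le> n * n" by simp
  then have "\<delta> * n \<le> (\<Sum>x\<in>V. deg x)"
    using nf n\<delta> unfolding M power2_eq_square by linarith
  then have "2 * ((\<Sum>x\<in>V. deg x) - \<delta> * k)\<^sup>2 \<le> (n - k) * (n * (\<Sum>x\<in>V. deg x))"
    using card_low_degree[OF S \<delta>(1)] by (simp add: n_def k_def)
  then have "2 * (n\<^sup>2 / 2 - (2 * n * f + \<delta> * k))\<^sup>2 \<le> (n - k) * (n * (n\<^sup>2 / 2 - 2 * n * f))"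
    by (simp add: M algebra_simps)
  \<comment> \<open>Only the nonnegative square of \<open>2 * n * f + \<delta> * k\<close> is
    discarded; \<open>n ^ 4 / 2\<close> then cancels and an inequality linear in \<open>k\<close>
    remains.\<close>
  moreover have "2 * (n\<^sup>2 / 2 - (2 * n * f + \<delta> * k))\<^sup>2 \<ge> n ^ 4 / 2 - 2 * n\<^sup>2 * (2 * n * f + \<delta> * k)"
    using zero_le_power2[of "2 * n * f + \<delta> * k"]
    by (simp add: power2_diff power2_eq_square power4_eq_xxxx algebra_simps)
  ultimately have "n ^ 4 / 2 - 2 * n\<^sup>2 * (2 * n * f + \<delta> * k) \<le> (n - k) * (n * (n\<^sup>2 / 2 - 2 * n * f))"
    by linarith
  then have "n\<^sup>2 * (n * k / 2) \<le> n\<^sup>2 * (2 * n * f + 2 * f * k + 2 * \<delta> * k)"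
    by (simp add: power2_eq_square power4_eq_xxxx algebra_simps diff_divide_distrib)
  then have *: "n * k / 2 \<le> 2 * n * f + 2 * f * k + 2 * \<delta> * k"
    using n by simp
  have "f * k \<le> n / 1000 * k" "\<delta> * k \<le> 12 / 1000 * n * k"
    using k f \<delta> by (auto intro!: mult_right_mono simp del: times_divide_eq_left)
  moreover have "0 \<le> n * k" "0 \<le> n * f"
    using n k f by auto
  \<comment> \<open>The terms in \<open>k\<close> on the right of \<open>*\<close> take up at most
    0.026 of the 0.5 on the left, and 2 / 0.474 is below 5.\<close>
  ultimately have "n * k \<le> n * (5 * f)"
    using * by linarith
  then have k5: "k \<le> 5 * f"
    using n by simp
  have "(\<Sum>x\<in>V. deg x) \<le> 2 * k * b * \<delta>"
    unfolding k_def \<delta>_def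
  proof (rule sum_deg_le_low_degree[OF codeg_le apex])
    show "(\<Sum>x\<in>V. deg x) = (real (card V))\<^sup>2 / 2 - 2 * real (card V) * f"
      using M by (simp only: n_def)
  qed (use f b in simp_all)
  also have "\<dots> \<le> 2 * (5 * f) * b * (8 * (f + b))"
    using k5 b f k \<delta> by (intro mult_mono) (simp_all add: \<delta>_def)
  finally have "n\<^sup>2 / 2 - 2 * n * f \<le> 80 * (f * (f + b) * b)"
    by (simp add: M mult_ac)
  \<comment> \<open>Since \<open>n * f\<close> is at most \<open>n * n / 1000\<close>, the left side
    is at least 0.498 times \<open>n * n\<close>, and 0.498 / 80 exceeds 1 / 1250.\<close>
  then show ?thesis
    using nf \<open>0 \<le> n * n\<close> unfolding power2_eq_square by linarith
qed

end

section \<open>From sets of edges and books to the adjacency matrix\<close>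

lemma finite_books:
  assumes "simple_graph V E"
  shows "finite {card B | B. book V E B}"
proof -
  have "finite (triangles V E)"
    using assms by (simp add: simple_graph_def triangles_def finite_imp_finite_nsets)
  moreover have "{card B | B. book V E B} \<subseteq> card ` Pow (triangles V E)"
    by (auto simp: book_def)
  ultimately show ?thesis
    by (meson finite_Pow_iff finite_imageI finite_subset)
qed

text \<open>Common neighbours differ from \<open>x\<close> and \<open>y\<close>, so adding them to
  the edge gives distinct triangles, which form a book on that edge.\<close>

lemma common_neighbours_le_bk:
  assumes G: "simple_graph V E" and xy: "{x, y} \<in> E"
  shows "card {z \<in> V. {x, z} \<in> E \<and> {y, z} \<in> E} \<le> bk V E"
proof -
  have edge: "u \<in> V \<and> v \<in> V \<and> u \<noteq> v" if "{u, v} \<in> E" for u v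
    using G that unfolding simple_graph_def by (meson doubleton_in_nsets_2 subsetD)
  let ?Z = "{z \<in> V. {x, z} \<in> E \<and> {y, z} \<in> E}"
  have "inj_on (\<lambda>z. {x, y, z}) ?Z"
  proof (rule inj_onI)
    fix z w assume "z \<in> ?Z" "{x, y, z} = {x, y, w}"
    moreover from this have "z \<noteq> x" "z \<noteq> y"
      using edge[of x z] edge[of y z] by auto
    ultimately show "z = w" by blast
  qed
  then have "card ?Z = card ((\<lambda>z. {x, y, z}) ` ?Z)"
    by (simp add: card_image)
  moreover have "book V E ((\<lambda>z. {x, y, z}) ` ?Z)"
    unfolding book_def
  proof (intro conjI bexI[OF _ xy])
    show "(\<lambda>z. {x, y, z}) ` ?Z \<subseteq> triangles V E"
    proof (intro image_subsetI)
      fix z assume "z \<in> ?Z"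
      then have E: "{x, z} \<in> E" "{y, z} \<in> E" by auto
      have "{y, x} \<in> E" "{z, x} \<in> E" "{z, y} \<in> E"
        using xy E by (simp_all add: insert_commute)
      then have "clique {x, y, z} E"
        using xy E unfolding clique_def by blast
      then show "{x, y, z} \<in> triangles V E"
        using edge[OF xy] edge[OF E(1)] edge[OF E(2)] by (simp add: triangles_def nsets_def)
    qed
  qed auto
  ultimately show ?thesis
    unfolding bk_def by (intro Max_ge finite_books[OF G]) auto
qed

lemma edge_in_triangle_common_neighbour:
  assumes "T \<in> triangles V E" "{x, y} \<subseteq> T" "x \<noteq> y"
  obtains z where "z \<in> V" "{x, z} \<in> E" "{y, z} \<in> E"
proof -
  have T: "T \<subseteq> V" "card T = 3" "clique T E" "finite T"
    using assms by (auto simp: triangles_def nsets_def)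
  have "card (T - {x, y}) = 1"
    using assms T by (simp add: card_Diff_subset)
  then obtain z where "z \<in> T" "z \<noteq> x" "z \<noteq> y"
    by (metis Diff_iff card_1_singletonE insert_iff)
  moreover from this have "z \<in> V" "{x, z} \<in> E" "{y, z} \<in> E"
    using T(1,3) assms(2) by (auto simp: clique_def)
  ultimately show thesis
    using that by blast
qed

lemma sum_adjacency_eq_card:
  assumes "simple_graph V E"
  shows "(\<Sum>x\<in>V. \<Sum>y\<in>V. of_bool ({x, y} \<in> E)) = 2 * real (card E)"
proof -
  have V: "finite V" and E: "E \<subseteq> nsets V 2"
    using assms by (auto simp: simple_graph_def)
  have "(\<Sum>x\<in>V. \<Sum>y\<in>V. of_bool ({x, y} \<in> E)) = (\<Sum>(x, y)\<in>V \<times> V. of_bool ({x, y} \<in> E) :: real)"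
    by (simp add: sum.cartesian_product)
  \<comment> \<open>Ordered pairs are grouped by the edge they span; each edge comes from exactly
    two pairs.\<close>
  also have "\<dots> = (\<Sum>p\<in>V \<times> V. \<Sum>e\<in>E. of_bool ({fst p, snd p} = e))"
    using V E finite_subset[OF E finite_imp_finite_nsets[OF V]]
    by (intro sum.cong refl) (auto simp: of_bool_def)
  also have "\<dots> = (\<Sum>e\<in>E. \<Sum>p\<in>V \<times> V. of_bool ({fst p, snd p} = e))"
    by (rule sum.swap)
  also have "\<dots> = (\<Sum>e\<in>E. 2)"
  proof (rule sum.cong[OF refl])
    fix e assume "e \<in> E"
    then obtain u v where e: "e = {u, v}" "u \<in> V" "v \<in> V" "u \<noteq> v"
      using E by (auto elim!: nsets2_E)
    then have "{p \<in> V \<times> V. {fst p, snd p} = e} = {(u, v), (v, u)}"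
      by (auto simp: doubleton_eq_iff)
    then show "(\<Sum>p\<in>V \<times> V. of_bool ({fst p, snd p} = e)) = (2 :: real)"
      using e V by (simp add: of_bool_def sum.If_cases Int_def)
  qed
  finally show ?thesis by simp
qed

theorem theorem1p3:
  fixes f :: "nat \<Rightarrow> real" and n :: nat
    and V :: "'a set" and E :: "'a set set"
  assumes f_pos: "\<And>m. m > 0 \<Longrightarrow> f m > 0"
    and n_pos: "n > 0"
    and f_le: "f n \<le> real n / 1000"
    and graph: "simple_graph V E"
    and card_V: "card V = n"
    and card_E: "real (card E) = (real n)^2 / 4 - real n * f n"
    and edge_in_triangle: "\<And>e. e \<in> E \<Longrightarrow> \<exists>T \<in> triangles V E. e \<subseteq> T"
  shows "real (bk V E) > real n / 1000
       \<or> f n * (f n + real (bk V E)) * real (bk V E) \<ge> (real n)^2 / 1250"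
proof (rule disjCI)
  assume "\<not> (real n)^2 / 1250 \<le> f n * (f n + real (bk V E)) * real (bk V E)"
  moreover have "(real n)^2 / 1250 \<le> f n * (f n + real (bk V E)) * real (bk V E)"
    if b_le: "real (bk V E) \<le> real n / 1000"
  proof -
    have V: "finite V" and E: "E \<subseteq> nsets V 2"
      using graph by (auto simp: simple_graph_def)
    have nbr: "\<exists>z\<in>V. {x, z} \<in> E \<and> {y, z} \<in> E" if "{x, y} \<in> E" for x y
    proof -
      have "x \<noteq> y"
        using E that by (meson doubleton_in_nsets_2 subsetD)
      then show ?thesis
        using edge_in_triangle[OF that] edge_in_triangle_common_neighbour by metis
    qed
    interpret adjacency V "\<lambda>x y. of_bool ({x, y} \<in> E)"
      by unfold_locales (auto simp: V insert_commute of_bool_def)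
    have codeg: "codeg x y = card {z \<in> V. {x, z} \<in> E \<and> {y, z} \<in> E}" for x y
      unfolding codeg_def of_bool_conj[symmetric] using V by (simp add: Int_def)
    \<comment> \<open>The bound on \<open>f n\<close> forces an edge to exist. Its triangle is a
      book of size one, so \<open>bk V E\<close> is positive, as \<open>book_bound\<close>
      requires.\<close>
    have "real n * f n \<le> real n * (real n / 1000)"
      using f_le by (intro mult_left_mono) auto
    moreover have "0 < real n * real n"
      using n_pos by simp
    ultimately have "real (card E) > 0"
      unfolding card_E power2_eq_square by simp
    then obtain e where "e \<in> E"
      by fastforce
    then obtain x y where xy: "{x, y} \<in> E"
      using E by (metis nsets2_E subsetD)
    have "{z \<in> V. {x, z} \<in> E \<and> {y, z} \<in> E} \<noteq> {}"
      using nbr[OF xy] by blast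
    then have "0 < card {z \<in> V. {x, z} \<in> E \<and> {y, z} \<in> E}"
      using V by (simp add: card_gt_0_iff)
    then have b_pos: "0 < real (bk V E)"
      using common_neighbours_le_bk[OF graph xy] by simp
    have "(\<Sum>x\<in>V. deg x) = 2 * real (card E)"
      using sum_adjacency_eq_card[OF graph] by (simp add: deg_def)
    then have M: "(\<Sum>x\<in>V. deg x) = (real (card V))\<^sup>2 / 2 - 2 * real (card V) * f n"
      by (simp add: card_E card_V)
    have "(real (card V))\<^sup>2 / 1250 \<le> f n * (f n + real (bk V E)) * real (bk V E)"
    proof (rule book_bound[OF _ _ b_pos _ f_pos[OF n_pos] _ M])
      fix x y assume "of_bool ({x, y} \<in> E) = (1 :: real)"
      then have xy: "{x, y} \<in> E" by simp
      then show "codeg x y \<le> real (bk V E)"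
        using common_neighbours_le_bk[OF graph] by (simp add: codeg)
      show "\<exists>z\<in>V. of_bool ({x, z} \<in> E) = (1 :: real) \<and> of_bool ({y, z} \<in> E) = (1 :: real)"
        using nbr[OF xy] by simp
    qed (use b_le f_le card_V in auto)
    then show ?thesis by (simp add: card_V)
  qed
  ultimately show "real (bk V E) > real n / 1000"
    by linarith
qed

end
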